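(* For every $k\in(0,\pi)$, there exists a Riemannian $2$-disk $(D^2,\partial D^2,g)$ with strictly convex boundary, nonnegative interior Gaussian curvature and total signed boundary curvature $\int_{\partial D^2}\kappa=k$, and there exists $\theta\in(0,\pi/2)$, such that $(D^2,\partial D^2,g)$ does not admit a capillary embedded geodesic with contact angle $\theta$.
   Context: A Riemannian $2$-disk $(D^2,\partial D^2,g)$ is a closed $2$-disk $D^2$ with boundary $\partial D^2$ and a Riemannian metric $g$; $\kappa$ is the geodesic curvature of $\partial D^2$ with respect to the inward normal, and the boundary is strictly convex if $\kappa>0$. For $\Omega\subset D^2$, the relative boundary $\partial_{rel}(\Omega)$ is the set of points of $D^2$ lying neither in the interior of $\Omega$ nor in the interior of $D^2\setminus\Omega$, interiors being taken in the relative topology of $D^2$. $\mathcal{D}(D^2)$ is the set of domains $\Omega\subset D^2$ such that $\partial_{rel}(\Omega)$ is a simple curve segment with endpoints on $\partial D^2$ (empty relative boundary is allowed, so $\emptyset, D^2\in\mathcal{D}(D^2)$). Capillary embedded geodesic with contact angle $\theta$: an embedded geodesic segment $\gamma=\partial_{rel}(\Omega)$, with $\Omega\in\mathcal{D}(D^2)$ connected, whose two endpoints $p_1,p_2$ lie on $\partial D^2$ and such that $\langle\eta,\overline{\nu}\rangle=-\cos\theta$ at $p_1$ and $p_2$. Here, at an endpoint of $\gamma$, $\eta$ is the unit vector tangent to $\gamma$ pointing out of $\gamma$, and $\overline{\nu}$ is the unit vector tangent to $\partial D^2$ pointing out of the boundary arc $\partial\Omega\cap\partial D^2$. *)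

theory Defs
  imports "HOL-Analysis.Analysis"
begin

text \<open>
  The closed 2-disk is modelled by the closed unit disk of the plane. This is no restriction:
  every smooth closed 2-disk is diffeomorphic to it, and a metric can be pulled back.
\<close>

abbreviation D2 :: "(real^2) set" where
  "D2 \<equiv> cball 0 1"

abbreviation bdry_D2 :: "(real^2) set" where
  "bdry_D2 \<equiv> sphere 0 1"

definition bd_pt :: "real \<Rightarrow> real^2" where
  "bd_pt t = vector [cos t, sin t]"

definition partial :: "2 \<Rightarrow> (real^2 \<Rightarrow> real) \<Rightarrow> real^2 \<Rightarrow> real" where
  "partial i f x = frechet_derivative f (at x) (axis i 1)"

text \<open>To be used for open \<open>U\<close> only.\<close>

fun C_k_on :: "nat \<Rightarrow> (real^2 \<Rightarrow> real) \<Rightarrow> (real^2) set \<Rightarrow> bool" where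
  "C_k_on 0 f U \<longleftrightarrow> continuous_on U f"
| "C_k_on (Suc k) f U \<longleftrightarrow> f differentiable_on U \<and> (\<forall>i. C_k_on k (partial i f) U)"

definition smooth_on :: "(real^2 \<Rightarrow> real) \<Rightarrow> (real^2) set \<Rightarrow> bool" where
  "smooth_on f U \<longleftrightarrow> (\<forall>k. C_k_on k f U)"

text \<open>
  A metric is given by its Gram matrix in the standard coordinates. Smoothness up to the boundary
  is smoothness on an open neighbourhood of the closed disk. By continuity, the derivatives of
  \<open>g\<close> at points of \<open>D2\<close> depend only on the values of \<open>g\<close> on \<open>D2\<close>, so the particular
  extension of \<open>g\<close> beyond \<open>D2\<close> plays no role below.
\<close>

definition riemannian_disk :: "(real^2 \<Rightarrow> real^2^2) \<Rightarrow> bool" where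
  "riemannian_disk g \<longleftrightarrow>
     (\<exists>U. open U \<and> D2 \<subseteq> U \<and> (\<forall>i j. smooth_on (\<lambda>x. g x $ i $ j) U)) \<and>
     (\<forall>x\<in>D2. transpose (g x) = g x \<and> (\<forall>v. v \<noteq> 0 \<longrightarrow> v \<bullet> (g x *v v) > 0))"

definition ginner :: "(real^2 \<Rightarrow> real^2^2) \<Rightarrow> real^2 \<Rightarrow> real^2 \<Rightarrow> real^2 \<Rightarrow> real" where
  "ginner g x u v = u \<bullet> (g x *v v)"

definition gnorm :: "(real^2 \<Rightarrow> real^2^2) \<Rightarrow> real^2 \<Rightarrow> real^2 \<Rightarrow> real" where
  "gnorm g x v = sqrt (ginner g x v v)"

text \<open>\<open>christoffel g l i j x\<close> is $\Gamma^l_{ij}(x)$.\<close>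

definition christoffel :: "(real^2 \<Rightarrow> real^2^2) \<Rightarrow> 2 \<Rightarrow> 2 \<Rightarrow> 2 \<Rightarrow> real^2 \<Rightarrow> real" where
  "christoffel g l i j x =
     (1/2) * (\<Sum>m\<in>UNIV. matrix_inv (g x) $ l $ m *
        (partial i (\<lambda>y. g y $ j $ m) x + partial j (\<lambda>y. g y $ i $ m) x
         - partial m (\<lambda>y. g y $ i $ j) x))"

text \<open>The \<open>l\<close>-th component of $R(\partial_i, \partial_j)\partial_k$, with the convention
  $R(X,Y) = \nabla_X\nabla_Y - \nabla_Y\nabla_X - \nabla_{[X,Y]}$.\<close>

definition riemann_tensor :: "(real^2 \<Rightarrow> real^2^2) \<Rightarrow> 2 \<Rightarrow> 2 \<Rightarrow> 2 \<Rightarrow> 2 \<Rightarrow> real^2 \<Rightarrow> real" where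
  "riemann_tensor g l i j k x =
     partial i (christoffel g l j k) x - partial j (christoffel g l i k) x
     + (\<Sum>m\<in>UNIV. christoffel g m j k x * christoffel g l i m x
                  - christoffel g m i k x * christoffel g l j m x)"

text \<open>$K = \langle R(\partial_1,\partial_2)\partial_2, \partial_1\rangle / \det g$.\<close>

definition gauss_curvature :: "(real^2 \<Rightarrow> real^2^2) \<Rightarrow> real^2 \<Rightarrow> real" where
  "gauss_curvature g x =
     (\<Sum>l\<in>UNIV. riemann_tensor g l 1 2 2 x * g x $ l $ 1) / det (g x)"

text \<open>Covariant derivative at time \<open>t\<close> of the vector field \<open>X\<close> along the curve \<open>c\<close>, both
  defined on the set of times \<open>S\<close> (one-sided derivatives at end points of \<open>S\<close>).\<close>

definition cov_deriv ::
  "(real^2 \<Rightarrow> real^2^2) \<Rightarrow> real set \<Rightarrow> (real \<Rightarrow> real^2) \<Rightarrow> (real \<Rightarrow> real^2) \<Rightarrow> real \<Rightarrow> real^2" where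
  "cov_deriv g S c X t =
     vector_derivative X (at t within S) +
     (\<chi> l. \<Sum>i\<in>UNIV. \<Sum>j\<in>UNIV.
        christoffel g l i j (c t) * vector_derivative c (at t within S) $ i * X t $ j)"

definition bd_speed :: "(real^2 \<Rightarrow> real^2^2) \<Rightarrow> real \<Rightarrow> real" where
  "bd_speed g t = gnorm g (bd_pt t) (vector_derivative bd_pt (at t))"

definition bd_tangent :: "(real^2 \<Rightarrow> real^2^2) \<Rightarrow> real \<Rightarrow> real^2" where
  "bd_tangent g t = vector_derivative bd_pt (at t) /\<^sub>R bd_speed g t"

text \<open>The \<open>g\<close>-gradient of $|x|^2/2$ is \<open>matrix_inv (g x) *v x\<close>; at boundary points it is
  \<open>g\<close>-orthogonal to the boundary and points out of the disk.\<close>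

definition inward_normal :: "(real^2 \<Rightarrow> real^2^2) \<Rightarrow> real^2 \<Rightarrow> real^2" where
  "inward_normal g x = - ((matrix_inv (g x) *v x) /\<^sub>R gnorm g x (matrix_inv (g x) *v x))"

text \<open>$\kappa = \langle \nabla_T T, N\rangle$ at the boundary point \<open>bd_pt t\<close>, with \<open>T\<close> the unit tangent
  and \<open>N\<close> the inward unit normal; the flat unit disk has $\kappa = 1$. The
  division by the speed turns the derivative in \<open>t\<close> into one with respect to arc length.\<close>

definition bd_curvature :: "(real^2 \<Rightarrow> real^2^2) \<Rightarrow> real \<Rightarrow> real" where
  "bd_curvature g t =
     ginner g (bd_pt t) (cov_deriv g UNIV bd_pt (bd_tangent g) t /\<^sub>R bd_speed g t)
       (inward_normal g (bd_pt t))"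

definition strictly_convex_bdry :: "(real^2 \<Rightarrow> real^2^2) \<Rightarrow> bool" where
  "strictly_convex_bdry g \<longleftrightarrow> (\<forall>t. bd_curvature g t > 0)"

definition rel_bdry :: "(real^2) set \<Rightarrow> (real^2) set" where
  "rel_bdry \<Omega> =
     D2 - (top_of_set D2 interior_of \<Omega>) - (top_of_set D2 interior_of (D2 - \<Omega>))"

text \<open>A domain is a relatively open subset; connectedness is not part of the notion and is
  required separately where it is needed.\<close>

definition segment_domains :: "(real^2) set set" where
  "segment_domains = {\<Omega>. openin (top_of_set D2) \<Omega> \<and>
     (rel_bdry \<Omega> = {} \<or>
      (\<exists>c. arc c \<and> path_image c = rel_bdry \<Omega> \<and>
           pathstart c \<in> bdry_D2 \<and> pathfinish c \<in> bdry_D2))}"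

abbreviation velocity :: "(real \<Rightarrow> real^2) \<Rightarrow> real \<Rightarrow> real^2" where
  "velocity c t \<equiv> vector_derivative c (at t within {0..1})"

text \<open>Affinely parametrised on \<open>{0..1}\<close>.\<close>

definition embedded_geodesic :: "(real^2 \<Rightarrow> real^2^2) \<Rightarrow> (real \<Rightarrow> real^2) \<Rightarrow> bool" where
  "embedded_geodesic g c \<longleftrightarrow>
     arc c \<and> path_image c \<subseteq> D2 \<and>
     (\<forall>t\<in>{0..1}. c differentiable (at t within {0..1}) \<and>
        velocity c differentiable (at t within {0..1}) \<and>
        velocity c t \<noteq> 0 \<and>
        cov_deriv g {0..1} c (velocity c) t = 0)"

text \<open>\<open>\<nu>\<close> is the \<open>g\<close>-unit tangent vector of the boundary circle at \<open>p\<close> that points out of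
  the boundary arc \<open>A\<close>: it is the velocity at \<open>t = 0\<close> of the boundary curve
  \<open>t \<mapsto> bd_pt (a + s * t)\<close>, which leaves \<open>A\<close> at that time.\<close>

definition outward_tangent ::
  "(real^2 \<Rightarrow> real^2^2) \<Rightarrow> (real^2) set \<Rightarrow> real^2 \<Rightarrow> real^2 \<Rightarrow> bool" where
  "outward_tangent g A p \<nu> \<longleftrightarrow> gnorm g p \<nu> = 1 \<and>
     (\<exists>a s. p = bd_pt a \<and> \<nu> = s *\<^sub>R vector_derivative bd_pt (at a) \<and>
        (\<forall>\<^sub>F t in at_right 0. bd_pt (a - s * t) \<in> A \<and> bd_pt (a + s * t) \<notin> A))"

text \<open>The contact condition for the boundary arc \<open>A\<close> at an end point \<open>p\<close> where the geodesic
  leaves with (not necessarily unit) tangent vector \<open>w\<close>.\<close>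

definition contact_angle ::
  "(real^2 \<Rightarrow> real^2^2) \<Rightarrow> real \<Rightarrow> (real^2) set \<Rightarrow> real^2 \<Rightarrow> real^2 \<Rightarrow> bool" where
  "contact_angle g \<theta> A p w \<longleftrightarrow>
     (\<exists>\<nu>. outward_tangent g A p \<nu> \<and> ginner g p (w /\<^sub>R gnorm g p w) \<nu> = - cos \<theta>)"

definition capillary_embedded_geodesic ::
  "(real^2 \<Rightarrow> real^2^2) \<Rightarrow> real \<Rightarrow> (real^2) set \<Rightarrow> bool" where
  "capillary_embedded_geodesic g \<theta> \<gamma> \<longleftrightarrow>
     (\<exists>\<Omega> c. \<Omega> \<in> segment_domains \<and> connected \<Omega> \<and> \<gamma> = rel_bdry \<Omega> \<and>
        embedded_geodesic g c \<and> path_image c = \<gamma> \<and>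
        pathstart c \<in> bdry_D2 \<and> pathfinish c \<in> bdry_D2 \<and>
        contact_angle g \<theta> (frontier \<Omega> \<inter> bdry_D2) (pathstart c) (- velocity c 0) \<and>
        contact_angle g \<theta> (frontier \<Omega> \<inter> bdry_D2) (pathfinish c) (velocity c 1))"

end

theory Submission
  imports Defs
begin

text \<open>
  The example is a flat cone whose apex has been rounded off. On a flat cone of total angle \<open>k\<close>,
  truncated at distance 1 from the apex, the boundary has total curvature \<open>k\<close>. Unrolling the cone
  turns a geodesic that leaves the boundary at angle \<open>\<theta>\<close> into a chord of the unit circle, which
  subtends the angle \<open>2 * \<theta>\<close> at the apex and stays at distance at least \<open>cos \<theta>\<close> from it. If
  \<open>2 * \<theta> > k\<close>, the chord winds more than once around the cone and therefore crosses itself. The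
  choice \<open>k / 2 < \<theta> < pi / 2\<close> is possible exactly when \<open>k < pi\<close>. Rounding the apex on a small
  scale changes the winding of such a chord only a little, so the crossing persists.

  The rotationally symmetric metric \<open>M(r\<^sup>2)\<^sup>2 dr\<^sup>2 + r\<^sup>2 d\<phi>\<^sup>2\<close> with
  \<open>M(q) = 1 + c * q / (q + e)\<close> makes this explicit. In Cartesian coordinates it is
  $I + p(|x|^2)\, x x^T$ with \<open>1 + q * p(q) = M(q)\<^sup>2\<close>, hence rational and smooth at the origin. Its
  curvature has the sign of \<open>M'\<close>, so it is nonnegative; it concentrates at the apex as \<open>e\<close> tends
  to 0. The boundary has curvature \<open>1 / M(1)\<close> and length \<open>2 * pi\<close>, and \<open>c\<close> is chosen so that
  this gives \<open>k\<close> in total.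

  The geodesic equation is a central force law, so angular momentum \<open>L\<close> and energy \<open>E\<close> are
  conserved. Let \<open>C = L / sqrt E\<close>; the contact condition says \<open>\<bar>C\<bar> = cos \<theta>\<close>. A signed square root
  \<open>\<sigma>\<close> of \<open>|x|\<^sup>2 - C\<^sup>2\<close> increases strictly along the geodesic (\<open>signed_radius_derivative\<close>), and
  the polar angle is a function of \<open>\<sigma>\<close> with \<open>d\<phi>/d\<sigma> = C * M(q) / q\<close>, where \<open>q = C\<^sup>2 + \<sigma>\<^sup>2\<close>
  (\<open>geodesic_position\<close>). A chord from boundary to boundary has \<open>\<sigma>\<close> running over a symmetric
  interval, and if the angle reaches \<open>pi\<close> on one half of it, then two opposite values of \<open>\<sigma>\<close>
  give the same point (\<open>chord_sweep_le_pi\<close>). For the chosen \<open>M\<close> the angle is a sum of two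
  arctangents, whose value at the end of the chord tends to \<open>2 * pi * \<theta> / k > pi\<close>
  (\<open>ex_cone_sweep_gt_pi\<close>).
\<close>

section \<open>Smooth functions on the plane\<close>

lemma partial_eqI: "(f has_derivative D) (at x) \<Longrightarrow> partial i f x = D (axis i 1)"
  unfolding partial_def using frechet_derivative_at by metis

lemma C_k_on_Suc_imp: "C_k_on (Suc k) f UNIV \<Longrightarrow> C_k_on k f UNIV"
proof (induction k arbitrary: f)
  case 0
  then show ?case by (auto intro: differentiable_imp_continuous_on)
next
  case (Suc k)
  then show ?case by (metis C_k_on.simps(2))
qed

lemma C_k_on_const: "C_k_on k (\<lambda>x. a) UNIV"
proof (induction k arbitrary: a)
  case (Suc k)
  have "partial i (\<lambda>x. a) = (\<lambda>x. 0)" for i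
    by (rule ext, subst partial_eqI[OF has_derivative_const]) simp
  with Suc show ?case by simp
qed simp

lemma C_k_on_coord: "C_k_on k (\<lambda>x. x $ j) UNIV"
proof (cases k)
  case (Suc n)
  have D: "((\<lambda>x. x $ j) has_derivative (\<lambda>h. h $ j)) (at x)" for x :: "real^2"
    by (rule bounded_linear_imp_has_derivative[OF bounded_linear_vec_nth])
  have "partial i (\<lambda>x. x $ j) = (\<lambda>x. axis i 1 $ j)" for i
    by (rule ext, rule partial_eqI[OF D])
  moreover have "(\<lambda>x::real^2. x $ j) differentiable_on UNIV"
    using D by (auto simp: differentiable_on_def differentiable_def)
  ultimately show ?thesis using Suc C_k_on_const by simp
qed (auto intro: continuous_intros)

lemma C_k_on_add:
  "C_k_on k f UNIV \<Longrightarrow> C_k_on k h UNIV \<Longrightarrow> C_k_on k (\<lambda>x. f x + h x) UNIV"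
proof (induction k arbitrary: f h)
  case (Suc k)
  then have d: "f differentiable at x" "h differentiable at x" for x
    by (auto simp: differentiable_on_def)
  have "partial i (\<lambda>x. f x + h x) = (\<lambda>x. partial i f x + partial i h x)" for i
    by (rule ext, subst partial_eqI[OF has_derivative_add[OF
          d(1)[unfolded frechet_derivative_works] d(2)[unfolded frechet_derivative_works]]])
       (simp add: partial_def)
  with Suc show ?case by (auto intro: differentiable_on_add)
qed (auto intro: continuous_intros)

lemma C_k_on_mult:
  "C_k_on k f UNIV \<Longrightarrow> C_k_on k h UNIV \<Longrightarrow> C_k_on k (\<lambda>x. f x * h x) UNIV"
proof (induction k arbitrary: f h)
  case (Suc k)
  then have d: "f differentiable at x" "h differentiable at x" for x
    by (auto simp: differentiable_on_def)
  have "partial i (\<lambda>x. f x * h x) = (\<lambda>x. f x * partial i h x + partial i f x * h x)" for i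
    by (rule ext, subst partial_eqI[OF has_derivative_mult[OF
          d(1)[unfolded frechet_derivative_works] d(2)[unfolded frechet_derivative_works]]])
       (simp add: partial_def)
  moreover have "C_k_on k f UNIV" "C_k_on k h UNIV"
    using Suc.prems by (blast intro: C_k_on_Suc_imp)+
  ultimately show ?case
    using Suc by (auto intro!: C_k_on_add)
qed (auto intro: continuous_intros)

lemma C_k_on_inverse:
  assumes "C_k_on k f UNIV" and nz: "\<And>x. f x \<noteq> 0"
  shows "C_k_on k (\<lambda>x. inverse (f x)) UNIV"
  using assms(1)
proof (induction k)
  case 0
  then show ?case using nz by (auto intro: continuous_intros)
next
  case (Suc k)
  then have d: "f differentiable at x" for x
    by (auto simp: differentiable_on_def)
  have D: "((\<lambda>x. inverse (f x)) has_derivative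
     (\<lambda>v. - (inverse (f x) * frechet_derivative f (at x) v * inverse (f x)))) (at x)" for x
    by (rule Deriv.has_derivative_inverse[OF nz d[unfolded frechet_derivative_works]])
  have P: "partial i (\<lambda>x. inverse (f x)) =
      (\<lambda>x. (- 1) * (partial i f x * (inverse (f x) * inverse (f x))))" for i
    by (rule ext, subst partial_eqI[OF D]) (simp add: partial_def)
  have "C_k_on k (\<lambda>x. inverse (f x)) UNIV"
    using Suc.IH C_k_on_Suc_imp[OF Suc.prems] .
  moreover have "C_k_on k (partial i f) UNIV" for i
    using Suc.prems by simp
  ultimately have "C_k_on k (partial i (\<lambda>x. inverse (f x))) UNIV" for i
    unfolding P by (intro C_k_on_mult[OF C_k_on_const] C_k_on_mult)
  moreover have "(\<lambda>x. inverse (f x)) differentiable_on UNIV"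
    using D by (auto simp: differentiable_on_def differentiable_def)
  ultimately show ?case by simp
qed

section \<open>Rotationally symmetric metrics and their curvature\<close>

text \<open>
  In polar coordinates this is \<open>(1 + q * p q) dr\<^sup>2 + r\<^sup>2 d\<phi>\<^sup>2\<close> with \<open>q = r\<^sup>2\<close>: the radius is
  normalised so that circles about the origin keep their Euclidean length. It is also the metric
  that the graph of a radial function \<open>h\<close> inherits from space, with \<open>q * p q = h'(r)\<^sup>2\<close>.
\<close>

definition radial_metric :: "(real \<Rightarrow> real) \<Rightarrow> real^2 \<Rightarrow> real^2^2" where
  "radial_metric p x = (\<chi> i j. (if i = j then 1 else 0) + p (x \<bullet> x) * (x $ i * x $ j))"

lemma inner_self_2: "x \<bullet> x = x $ 1 * x $ 1 + x $ 2 * x $ 2" for x :: "real^2"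
  by (simp add: inner_vec_def sum_2)

lemma radial_metric_mult_vector:
  "radial_metric p x *v v = v + (p (x \<bullet> x) * (x \<bullet> v)) *\<^sub>R x"
proof -
  have "(radial_metric p x *v v) $ i = (v + (p (x \<bullet> x) * (x \<bullet> v)) *\<^sub>R x) $ i" for i
    using exhaust_2[of i]
    by (auto simp: radial_metric_def matrix_vector_mult_def sum_2 inner_vec_def[of _ v] algebra_simps)
  then show ?thesis by (simp add: vec_eq_iff)
qed

lemma ginner_radial_metric:
  "ginner (radial_metric p) x u v = u \<bullet> v + p (x \<bullet> x) * ((x \<bullet> u) * (x \<bullet> v))"
  by (simp add: ginner_def radial_metric_mult_vector inner_right_distrib inner_commute)

lemma det_radial_metric: "det (radial_metric p x) = 1 + (x \<bullet> x) * p (x \<bullet> x)"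
  by (simp add: det_2 radial_metric_def inner_vec_def sum_2 algebra_simps)

text \<open>
  Matrices $I + a\, x x^T$ with a fixed \<open>x\<close> are closed under multiplication, so the inverse of the
  Gram matrix can be sought in the same form.
\<close>

lemma rank_one_update_mult:
  fixes x :: "real^2"
  shows "((\<chi> i j. (if i = j then 1 else 0) + a * (x $ i * x $ j)) **
      (\<chi> i j. (if i = j then 1 else 0) + b * (x $ i * x $ j)))
    = (\<chi> i j. (if i = j then 1 else 0) + (a + b + a * b * (x \<bullet> x)) * (x $ i * x $ j) :: real^2^2)"
  unfolding vec_eq_iff forall_2 matrix_matrix_mult_def sum_2 inner_self_2
  by (simp, intro conjI; algebra)

lemma matrix_inv_radial_metric:
  assumes "1 + (x \<bullet> x) * p (x \<bullet> x) \<noteq> 0"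
  shows "matrix_inv (radial_metric p x) = radial_metric (\<lambda>q. - p q / (1 + q * p q)) x"
    (is "_ = ?B")
proof -
  define a b where "a = p (x \<bullet> x)" and "b = - a / (1 + (x \<bullet> x) * a)"
  have ab: "a + b + a * b * (x \<bullet> x) = 0"
    using assms by (simp add: a_def b_def field_simps)
  have 1: "radial_metric p x ** ?B = mat 1"
    unfolding radial_metric_def a_def[symmetric] b_def[symmetric] rank_one_update_mult ab
    by (simp add: mat_def)
  then have "\<exists>B. radial_metric p x ** B = mat 1 \<and> B ** radial_metric p x = mat 1"
    using matrix_left_right_inverse by blast
  then have "matrix_inv (radial_metric p x) ** radial_metric p x = mat 1"
    unfolding matrix_inv_def by (rule someI2_ex) simp
  then have "matrix_inv (radial_metric p x) ** (radial_metric p x ** ?B) = mat 1 ** ?B"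
    by (simp only: matrix_mul_assoc)
  then show ?thesis
    unfolding 1 by (simp only: matrix_mul_lid matrix_mul_rid)
qed

lemma has_derivative_radial:
  assumes "(f has_real_derivative f') (at (x \<bullet> x))"
  shows "((\<lambda>y. f (y \<bullet> y)) has_derivative (\<lambda>h. 2 * (x \<bullet> h) * f')) (at x)"
  by (rule has_derivative_eq_rhs, rule DERIV_compose_FDERIV[where g = "\<lambda>y. y \<bullet> y", OF assms])
     (auto intro!: derivative_eq_intros simp: inner_commute)

locale smooth_profile =
  fixes p dp :: "real \<Rightarrow> real"
  assumes dp: "\<And>q. q \<ge> 0 \<Longrightarrow> (p has_real_derivative dp q) (at q)"
    and dp_differentiable: "\<And>q. q \<ge> 0 \<Longrightarrow> dp differentiable (at q)"
    and nonneg: "\<And>q. q \<ge> 0 \<Longrightarrow> p q \<ge> 0"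
begin

abbreviation "g \<equiv> radial_metric p"

lemma metric_det_factor_pos: "q \<ge> 0 \<Longrightarrow> 1 + q * p q > 0"
  using nonneg[of q] by (simp add: add_pos_nonneg)

lemma metric_det_pos: "1 + (x \<bullet> x) * p (x \<bullet> x) > 0" for x :: "real^2"
  by (rule metric_det_factor_pos) simp

text \<open>
  The Christoffel symbols with lowered index are \<open>x $ l\<close> times a symmetric form, because
  the metric varies only in the radial direction; \<open>x\<close> is an eigenvector of the Gram matrix with
  eigenvalue \<open>1 + q * p q\<close>, which is the denominator.
\<close>

lemma christoffel_radial_metric:
  "christoffel g l i j x =
     x $ l * ((dp (x \<bullet> x) * (x $ i * x $ j) + p (x \<bullet> x) * (if i = j then 1 else 0))
       / (1 + (x \<bullet> x) * p (x \<bullet> x)))"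
proof -
  have Dp: "((\<lambda>y. p (y \<bullet> y)) has_derivative (\<lambda>h. 2 * (x \<bullet> h) * dp (x \<bullet> x))) (at x)"
    by (rule has_derivative_radial[OF dp]) simp
  have D: "((\<lambda>y. g y $ i $ j) has_derivative
     (\<lambda>h. 2 * (x \<bullet> h) * dp (x \<bullet> x) * (x $ i * x $ j)
       + p (x \<bullet> x) * (h $ i * x $ j + x $ i * h $ j))) (at x)" for i j
    unfolding radial_metric_def
    by (auto intro!: derivative_eq_intros Dp
        bounded_linear_imp_has_derivative[OF bounded_linear_vec_nth] simp: algebra_simps)
  have P: "partial k (\<lambda>y. g y $ i $ j) x =
     2 * x $ k * dp (x \<bullet> x) * (x $ i * x $ j)
     + p (x \<bullet> x) * ((if i = k then 1 else 0) * x $ j + x $ i * (if j = k then 1 else 0))" for i j k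
    by (subst partial_eqI[OF D]) (simp add: inner_axis, simp add: axis_def)
  have nz: "1 + (x \<bullet> x) * p (x \<bullet> x) \<noteq> 0" using metric_det_pos[of x] by simp
  define w where "w = 1 + (x \<bullet> x) * p (x \<bullet> x)"
  have n: "matrix_inv (g x) $ l $ m =
      (if l = m then 1 else 0) - p (x \<bullet> x) / w * (x $ l * x $ m)" for l m
    unfolding matrix_inv_radial_metric[of x p, OF nz] by (simp add: radial_metric_def w_def)
  have "christoffel g l i j x = (\<Sum>m\<in>UNIV. matrix_inv (g x) $ l $ m *
     (x $ m * (dp (x \<bullet> x) * (x $ i * x $ j) + p (x \<bullet> x) * (if i = j then 1 else 0))))"
    unfolding christoffel_def P sum_distrib_left by (intro sum.cong refl) (auto simp: algebra_simps)
  also have "\<dots> = (\<Sum>m\<in>UNIV. matrix_inv (g x) $ l $ m * x $ m)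
      * (dp (x \<bullet> x) * (x $ i * x $ j) + p (x \<bullet> x) * (if i = j then 1 else 0))"
    by (simp add: sum_distrib_right mult.assoc)
  also have "(\<Sum>m\<in>UNIV. matrix_inv (g x) $ l $ m * x $ m) = x $ l / w"
  proof -
    have "(\<Sum>m\<in>UNIV. matrix_inv (g x) $ l $ m * x $ m)
        = x $ l - p (x \<bullet> x) / w * (x $ l * (x \<bullet> x))"
      unfolding n sum_2 inner_self_2[of x] using exhaust_2[of l]
      by (elim disjE) (simp_all add: algebra_simps)
    also have "\<dots> = x $ l / w"
      using nz by (simp add: w_def field_simps)
    finally show ?thesis .
  qed
  finally show ?thesis by (simp add: w_def)
qed

text \<open>
  The Christoffel term of a covariant derivative is a multiple of the position vector. This is what
  makes the geodesic equation a central force law, and it also gives the boundary curvature.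
\<close>

lemma sum_christoffel:
  "(\<chi> l. \<Sum>i\<in>UNIV. \<Sum>j\<in>UNIV. christoffel g l i j x * v $ i * w $ j) =
     ((dp (x \<bullet> x) * ((x \<bullet> v) * (x \<bullet> w)) + p (x \<bullet> x) * (v \<bullet> w))
       / (1 + (x \<bullet> x) * p (x \<bullet> x))) *\<^sub>R x"
  unfolding vec_eq_iff christoffel_radial_metric
  by (simp add: sum_2 inner_vec_def[of _ v] inner_vec_def[of _ w] algebra_simps
      add_divide_distrib)

text \<open>
  With \<open>w = 1 + q * p q\<close> the right-hand side is minus the derivative of \<open>1 / w\<close> in \<open>q\<close>. Indeed, if
  \<open>f\<close> is the radius as a function of arc length \<open>s\<close> along a meridian, then \<open>(df/ds)\<^sup>2 = 1 / w\<close>, and the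
  classical formula $K = -f''/f$ for $ds^2 + f^2 d\phi^2$ turns into this derivative.
\<close>

lemma gauss_curvature_radial_metric:
  "gauss_curvature g x = (p (x \<bullet> x) + (x \<bullet> x) * dp (x \<bullet> x)) / (1 + (x \<bullet> x) * p (x \<bullet> x))\<^sup>2"
proof -
  \<comment> \<open>The Christoffel symbols are \<open>x $ l * (P q * x $ i * x $ j + S q * \<delta>)\<close>. The derivative of \<open>P\<close>
    cancels from the curvature, so only that of \<open>S\<close> has to be known.\<close>
  define P where "P q = dp q / (1 + q * p q)" for q
  define S where "S q = p q / (1 + q * p q)" for q
  define S' where "S' = P (x \<bullet> x) * (1 - (x \<bullet> x) * S (x \<bullet> x)) - (S (x \<bullet> x))\<^sup>2"
  have nz: "1 + (x \<bullet> x) * p (x \<bullet> x) \<noteq> 0" using metric_det_pos[of x] by simp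
  have "P differentiable (at (x \<bullet> x))"
    unfolding P_def[abs_def] using dp[of "x \<bullet> x"] dp_differentiable[of "x \<bullet> x"] nz
    by (intro differentiable_divide differentiable_add differentiable_mult differentiable_const
        differentiable_ident) (auto simp: real_differentiable_def)
  then obtain P' where P: "(P has_real_derivative P') (at (x \<bullet> x))"
    by (auto simp: real_differentiable_def)
  have "S' = (dp (x \<bullet> x) - (p (x \<bullet> x))\<^sup>2) / (1 + (x \<bullet> x) * p (x \<bullet> x))\<^sup>2"
    unfolding S'_def P_def S_def using nz
    by (simp add: field_simps power2_eq_square diff_divide_distrib)
  then have S: "(S has_real_derivative S') (at (x \<bullet> x))"
    unfolding S_def by (auto intro!: derivative_eq_intros dp simp: nz power2_eq_square algebra_simps)
  have ch: "christoffel g l i j =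
      (\<lambda>y. y $ l * (P (y \<bullet> y) * (y $ i * y $ j) + S (y \<bullet> y) * (if i = j then 1 else 0)))" for l i j
    unfolding christoffel_radial_metric P_def S_def by (auto simp: add_divide_distrib)
  have "((\<lambda>y. y $ l * (P (y \<bullet> y) * (y $ i * y $ j) + S (y \<bullet> y) * (if i = j then 1 else 0)))
      has_derivative
     (\<lambda>h. h $ l * (P (x \<bullet> x) * (x $ i * x $ j) + S (x \<bullet> x) * (if i = j then 1 else 0))
       + x $ l * (2 * (x \<bullet> h) * P' * (x $ i * x $ j) + P (x \<bullet> x) * (h $ i * x $ j + x $ i * h $ j)
         + 2 * (x \<bullet> h) * S' * (if i = j then 1 else 0)))) (at x)" for l i j
    by (auto intro!: derivative_eq_intros has_derivative_radial[OF P] has_derivative_radial[OF S]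
        bounded_linear_imp_has_derivative[OF bounded_linear_vec_nth] simp: algebra_simps)
  from partial_eqI[OF this] have pch: "partial k (christoffel g l i j) x =
       (if l = k then 1 else 0)
         * (P (x \<bullet> x) * (x $ i * x $ j) + S (x \<bullet> x) * (if i = j then 1 else 0))
       + x $ l * (2 * x $ k * P' * (x $ i * x $ j)
         + P (x \<bullet> x)
           * ((if i = k then 1 else 0) * x $ j + x $ i * (if j = k then 1 else 0))
         + 2 * x $ k * S' * (if i = j then 1 else 0))" for k l i j
    unfolding ch by (simp add: inner_axis, simp add: axis_def)
  \<comment> \<open>Everything is polynomial in \<open>a\<close>, \<open>b\<close>, \<open>s\<close>, \<open>t\<close>, \<open>w\<close> subject to one relation, which leaves an
    identity of polynomials.\<close>
  define w a b s t where "w = 1 + (x \<bullet> x) * p (x \<bullet> x)" and "a = x $ 1" and "b = x $ 2"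
    and "s = S (x \<bullet> x)" and "t = P (x \<bullet> x)"
  have q: "x \<bullet> x = a * a + b * b"
    unfolding a_def b_def by (rule inner_self_2)
  have pw: "p (x \<bullet> x) = s * w" "dp (x \<bullet> x) = t * w"
    using nz by (auto simp: s_def t_def w_def S_def P_def)
  have w: "w = 1 + (a * a + b * b) * (s * w)"
    unfolding pw(1)[symmetric] q[symmetric] by (simp add: w_def)
  have S'1: "S' = t * (1 - (a * a + b * b) * s) - s * s"
    unfolding S'_def q[symmetric] by (simp add: s_def t_def power2_eq_square)
  have "(\<Sum>l\<in>UNIV. riemann_tensor g l 1 2 2 x * g x $ l $ 1) = s + (a * a + b * b) * t"
    unfolding riemann_tensor_def pch unfolding ch sum_2
    unfolding a_def[symmetric] b_def[symmetric] s_def[symmetric] t_def[symmetric]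
      radial_metric_def S'1
    apply (simp add: pw flip: a_def b_def)
    using w apply algebra
    done
  then show ?thesis
    using nz unfolding gauss_curvature_def det_radial_metric q[symmetric] s_def t_def S_def P_def
    by (simp add: power2_eq_square add_divide_distrib)
qed

lemma ginner_self_pos: "v \<noteq> 0 \<Longrightarrow> ginner g x v v > 0"
  unfolding ginner_radial_metric using nonneg[of "x \<bullet> x"]
  by (simp add: add_pos_nonneg)

lemma riemannian_disk_radial_metric:
  assumes "\<And>k. C_k_on k (\<lambda>x. p (x \<bullet> x)) UNIV"
  shows "riemannian_disk g"
  unfolding riemannian_disk_def smooth_on_def
proof (intro conjI exI[of _ UNIV] ballI allI impI)
  fix i j k
  show "C_k_on k (\<lambda>x. g x $ i $ j) UNIV"
    unfolding radial_metric_def by (simp add: C_k_on_add C_k_on_mult C_k_on_const C_k_on_coord assms)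
next
  fix x show "transpose (g x) = g x"
    by (simp add: transpose_def radial_metric_def vec_eq_iff mult.commute)
next
  fix x v :: "real^2" assume "v \<noteq> 0"
  then show "v \<bullet> (g x *v v) > 0" by (rule ginner_self_pos[unfolded ginner_def])
qed auto

lemma has_vector_derivative_vector_2:
  assumes "(f has_real_derivative f') (at t within A)" "(h has_real_derivative h') (at t within A)"
  shows "((\<lambda>t. vector [f t, h t] :: real^2) has_vector_derivative vector [f', h']) (at t within A)"
proof -
  have *: "vector [u, v] = (u *\<^sub>R axis 1 1 + v *\<^sub>R axis 2 1 :: real^2)" for u v :: real
    by (simp add: vec_eq_iff forall_2 axis_def)
  show ?thesis
    unfolding * by (auto intro!: derivative_eq_intros assms)
qed

lemma vector_derivative_bd_pt: "vector_derivative bd_pt (at t) = vector [- sin t, cos t]"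
  unfolding bd_pt_def
  by (rule vector_derivative_at, rule has_vector_derivative_vector_2) (auto intro!: derivative_eq_intros)

lemma bd_pt_inner: "bd_pt t \<bullet> bd_pt t = 1" "bd_pt t \<bullet> vector [- sin t, cos t] = 0"
   "vector [- sin t, cos t] \<bullet> (vector [- sin t, cos t] :: real^2) = 1"
  by (auto simp: bd_pt_def inner_vec_def sum_2 simp flip: power2_eq_square)

lemma bd_speed_radial_metric: "bd_speed g t = 1"
  by (simp add: bd_speed_def gnorm_def vector_derivative_bd_pt ginner_radial_metric bd_pt_inner)

lemma bd_curvature_radial_metric: "bd_curvature g t = 1 / sqrt (1 + p 1)"
proof -
  have T: "bd_tangent g = (\<lambda>t. vector [- sin t, cos t])"
    by (rule ext) (simp add: bd_tangent_def bd_speed_radial_metric vector_derivative_bd_pt)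
  have "((\<lambda>t. vector [- sin t, cos t] :: real^2) has_vector_derivative vector [- cos t, - sin t]) (at t)"
    by (rule has_vector_derivative_vector_2) (auto intro!: derivative_eq_intros)
  also have "vector [- cos t, - sin t] = - bd_pt t"
    by (simp add: bd_pt_def vec_eq_iff forall_2)
  finally have "cov_deriv g UNIV bd_pt (bd_tangent g) t = - bd_pt t + (p 1 / (1 + p 1)) *\<^sub>R bd_pt t"
    unfolding cov_deriv_def sum_christoffel T vector_derivative_bd_pt
    by (simp add: bd_pt_inner vector_derivative_at)
  also have "\<dots> = - (1 / (1 + p 1)) *\<^sub>R bd_pt t"
    using metric_det_factor_pos[of 1] by (simp add: vec_eq_iff field_simps)
  finally have 1: "cov_deriv g UNIV bd_pt (bd_tangent g) t = - (1 / (1 + p 1)) *\<^sub>R bd_pt t" .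
  have "matrix_inv (g (bd_pt t)) *v bd_pt t = bd_pt t - (p 1 / (1 + p 1)) *\<^sub>R bd_pt t"
    using metric_det_factor_pos[of 1]
    by (simp add: matrix_inv_radial_metric bd_pt_inner radial_metric_mult_vector)
  also have "\<dots> = (1 / (1 + p 1)) *\<^sub>R bd_pt t"
    using metric_det_factor_pos[of 1] by (simp add: vec_eq_iff field_simps)
  finally have 2: "matrix_inv (g (bd_pt t)) *v bd_pt t = (1 / (1 + p 1)) *\<^sub>R bd_pt t" .
  have w: "1 + p 1 > 0"
    using metric_det_factor_pos[of 1] by simp
  have sq: "sqrt (1 / (1 + p 1)) = 1 / sqrt (1 + p 1)"
    by (simp add: real_sqrt_divide)
  have "ginner g (bd_pt t) ((1 / (1 + p 1)) *\<^sub>R bd_pt t) ((1 / (1 + p 1)) *\<^sub>R bd_pt t) = 1 / (1 + p 1)"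
    unfolding ginner_radial_metric using w
    by (simp add: bd_pt_inner add_divide_distrib[symmetric])
  then have 3: "gnorm g (bd_pt t) ((1 / (1 + p 1)) *\<^sub>R bd_pt t) = 1 / sqrt (1 + p 1)"
    unfolding gnorm_def by (simp only: sq)
  define a where "a = 1 / (1 + p 1)"
  have "bd_curvature g t = a * a * sqrt (1 + p 1) * (1 + p 1)"
    unfolding bd_curvature_def inward_normal_def 1[folded a_def] 2[folded a_def] 3[folded a_def]
      bd_speed_radial_metric ginner_radial_metric
    by (simp add: bd_pt_inner algebra_simps)
  also have "\<dots> = sqrt (1 + p 1) / (1 + p 1)"
    using w by (simp add: a_def)
  also have "\<dots> = 1 / sqrt (1 + p 1)"
    by (simp add: sqrt_divide_self_eq metric_det_factor_pos nonneg inverse_eq_divide)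
  finally show ?thesis .
qed

end

section \<open>Conservation laws for geodesics\<close>

context smooth_profile
begin

lemma geodesic_derivatives:
  fixes c t
  defines "k \<equiv> (dp (c t \<bullet> c t) * (c t \<bullet> velocity c t)\<^sup>2
      + p (c t \<bullet> c t) * (velocity c t \<bullet> velocity c t)) / (1 + (c t \<bullet> c t) * p (c t \<bullet> c t))"
  assumes "embedded_geodesic g c" and "t \<in> {0..1}"
  shows "(c has_vector_derivative velocity c t) (at t within {0..1})"
    and "(velocity c has_vector_derivative - k *\<^sub>R c t) (at t within {0..1})"
proof -
  have *: "c differentiable (at t within {0..1})" "velocity c differentiable (at t within {0..1})"
    "cov_deriv g {0..1} c (velocity c) t = 0"
    using assms unfolding embedded_geodesic_def by blast+
  show "(c has_vector_derivative velocity c t) (at t within {0..1})"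
    using *(1) by (simp add: vector_derivative_works)
  have "vector_derivative (velocity c) (at t within {0..1}) = - k *\<^sub>R c t"
    using *(3) unfolding cov_deriv_def sum_christoffel
    by (simp add: k_def power2_eq_square eq_neg_iff_add_eq_0)
  then show "(velocity c has_vector_derivative - k *\<^sub>R c t) (at t within {0..1})"
    using *(2) by (simp add: vector_derivative_works)
qed

end

lemma has_real_derivative_inner:
  fixes f h :: "real \<Rightarrow> 'a :: real_inner"
  assumes "(f has_vector_derivative f') (at t within A)" "(h has_vector_derivative h') (at t within A)"
  shows "((\<lambda>t. f t \<bullet> h t) has_real_derivative f t \<bullet> h' + f' \<bullet> h t) (at t within A)"
  using has_derivative_inner[OF assms[unfolded has_vector_derivative_def]]
  unfolding has_field_derivative_def by (rule has_derivative_eq_rhs) (auto simp: algebra_simps)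

lemma has_real_derivative_vec_nth:
  assumes "(f has_vector_derivative f') (at t within A)"
  shows "((\<lambda>t. f t $ i) has_real_derivative f' $ i) (at t within A)"
  using bounded_linear.has_vector_derivative[OF bounded_linear_vec_nth assms]
  by (simp add: has_real_derivative_iff_has_vector_derivative)

lemma lagrange_identity_2:
  "(x \<bullet> x) * (v \<bullet> v) = (x \<bullet> v)\<^sup>2 + (x $ 1 * v $ 2 - x $ 2 * v $ 1)\<^sup>2" for x v :: "real^2"
  unfolding inner_vec_def sum_2 by simp algebra

definition angular_momentum :: "(real \<Rightarrow> real^2) \<Rightarrow> real \<Rightarrow> real" where
  "angular_momentum c t = c t $ 1 * velocity c t $ 2 - c t $ 2 * velocity c t $ 1"

context smooth_profile
begin

definition energy :: "(real \<Rightarrow> real^2) \<Rightarrow> real \<Rightarrow> real" where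
  "energy c t = ginner g (c t) (velocity c t) (velocity c t)"

lemma angular_momentum_const:
  assumes c: "embedded_geodesic g c" and "t \<in> {0..1}"
  shows "angular_momentum c t = angular_momentum c 0"
proof -
  have "(angular_momentum c has_real_derivative 0) (at t within {0..1})" if "t \<in> {0..1}" for t
    unfolding angular_momentum_def[abs_def]
    by (rule derivative_eq_intros has_real_derivative_vec_nth geodesic_derivatives[OF c that] refl)+
       (simp add: algebra_simps)
  then have "\<exists>a. \<forall>t\<in>{0..1}. angular_momentum c t = a"
    by (intro has_field_derivative_zero_constant) auto
  then show ?thesis using assms(2) by auto
qed

lemma energy_const:
  assumes c: "embedded_geodesic g c" and "t \<in> {0..1}"
  shows "energy c t = energy c 0"
proof -
  have "(energy c has_real_derivative 0) (at t within {0..1})" if t: "t \<in> {0..1}" for t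
  proof -
    let ?q = "c t \<bullet> c t" and ?r = "c t \<bullet> velocity c t" and ?s = "velocity c t \<bullet> velocity c t"
    have 1: "energy c = (\<lambda>t. velocity c t \<bullet> velocity c t
        + p (c t \<bullet> c t) * ((c t \<bullet> velocity c t) * (c t \<bullet> velocity c t)))"
      unfolding energy_def[abs_def] ginner_radial_metric ..
    define k where "k = (dp ?q * ?r\<^sup>2 + p ?q * ?s) / (1 + ?q * p ?q)"
    note d = geodesic_derivatives[OF c t, folded k_def]
    have k: "k * (1 + ?q * p ?q) = dp ?q * (?r * ?r) + p ?q * ?s"
      using metric_det_pos[of "c t"] by (simp add: k_def power2_eq_square)
    have dq: "((\<lambda>t. p (c t \<bullet> c t)) has_real_derivative dp ?q * (2 * ?r)) (at t within {0..1})"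
      by (rule DERIV_chain2[OF dp has_real_derivative_inner[OF d(1) d(1), THEN DERIV_cong]])
         (auto simp: inner_commute)
    have "- (k * ?r) * 2 + (p ?q * ((- k * ?q + ?s) * ?r * 2) + dp ?q * (2 * ?r) * (?r * ?r)) = 0"
      using k by algebra
    then show ?thesis unfolding 1
      by (auto intro!: derivative_eq_intros has_real_derivative_inner d dq
          simp: inner_commute algebra_simps)
  qed
  then have "\<exists>a. \<forall>t\<in>{0..1}. energy c t = a"
    by (intro has_field_derivative_zero_constant) auto
  then show ?thesis using assms(2) by auto
qed

text \<open>
  On an unrolled flat cone this is proportional to arc length measured from the point closest to the
  apex. Like arc length it changes sign at that point, and it is smooth there, which a square root of
  \<open>|x|\<^sup>2 - C\<^sup>2\<close> with a fixed sign is not.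
\<close>

definition signed_radius :: "(real \<Rightarrow> real^2) \<Rightarrow> real \<Rightarrow> real" where
  "signed_radius c t =
     (c t \<bullet> velocity c t) * sqrt (1 + (c t \<bullet> c t) * p (c t \<bullet> c t)) / sqrt (energy c 0)"

lemma energy_pos:
  assumes "embedded_geodesic g c" shows "energy c 0 > 0"
proof -
  have "velocity c 0 \<noteq> 0" using assms unfolding embedded_geodesic_def by force
  then show ?thesis unfolding energy_def by (rule ginner_self_pos)
qed

text \<open>
  Lagrange's identity splits \<open>|x|\<^sup>2 |x'|\<^sup>2\<close> into the squares of the radial part and of the angular
  momentum; with \<open>|x'|\<^sup>2\<close> expressed by the energy, this is the first integral of the radial motion.
\<close>

lemma signed_radius_square:
  assumes c: "embedded_geodesic g c" and t: "t \<in> {0..1}"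
  shows "c t \<bullet> c t = (angular_momentum c 0)\<^sup>2 / energy c 0 + (signed_radius c t)\<^sup>2"
proof -
  have "energy c 0 * (c t \<bullet> c t) =
      (c t \<bullet> velocity c t)\<^sup>2 * (1 + (c t \<bullet> c t) * p (c t \<bullet> c t)) + (angular_momentum c 0)\<^sup>2"
    using lagrange_identity_2[of "c t" "velocity c t"]
    unfolding energy_const[OF assms, symmetric] angular_momentum_const[OF assms, symmetric]
    unfolding energy_def ginner_radial_metric angular_momentum_def by algebra
  moreover have "(signed_radius c t)\<^sup>2 =
      (c t \<bullet> velocity c t)\<^sup>2 * (1 + (c t \<bullet> c t) * p (c t \<bullet> c t)) / energy c 0"
    using metric_det_pos[of "c t"] energy_pos[OF c] unfolding signed_radius_def
    by (simp add: power_mult_distrib power_divide)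
  ultimately show ?thesis
    using energy_pos[OF c] by (simp add: field_simps)
qed

text \<open>
  Dividing the derivative of \<open>signed_radius_square\<close> by \<open>2 * signed_radius c t\<close> gives this value away from
  the closest point. The proof uses the geodesic equation instead, which covers that point as well.
\<close>

lemma signed_radius_derivative:
  assumes c: "embedded_geodesic g c" and t: "t \<in> {0..1}"
  shows "(signed_radius c has_real_derivative
     sqrt (energy c 0) / sqrt (1 + (c t \<bullet> c t) * p (c t \<bullet> c t))) (at t within {0..1})"
proof -
  let ?q = "c t \<bullet> c t" and ?r = "c t \<bullet> velocity c t" and ?s = "velocity c t \<bullet> velocity c t"
  define k where "k = (dp ?q * ?r\<^sup>2 + p ?q * ?s) / (1 + ?q * p ?q)"
  define e where "e = sqrt (energy c 0)"
  define m where "m = sqrt (1 + ?q * p ?q)"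
  note d = geodesic_derivatives[OF c t, folded k_def]
  have e: "e > 0" "?s + p ?q * (?r * ?r) = e * e"
    using energy_pos[OF c] energy_const[OF assms] by (auto simp: e_def energy_def ginner_radial_metric)
  have m: "m > 0" "m * m = 1 + ?q * p ?q"
    using metric_det_pos[of "c t"] by (auto simp: m_def)
  have k: "k * (m * m) = dp ?q * (?r * ?r) + p ?q * ?s"
    using m unfolding m(2)[symmetric] by (simp add: k_def power2_eq_square m(2)[symmetric])
  have q: "((\<lambda>t. c t \<bullet> c t) has_real_derivative 2 * ?r) (at t within {0..1})"
    by (rule has_real_derivative_inner[OF d(1) d(1), THEN DERIV_cong]) (auto simp: inner_commute)
  have dq: "((\<lambda>t. p (c t \<bullet> c t)) has_real_derivative dp ?q * (2 * ?r)) (at t within {0..1})"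
    by (rule DERIV_chain2[OF dp q]) auto
  have "((\<lambda>t. 1 + (c t \<bullet> c t) * p (c t \<bullet> c t)) has_real_derivative
      2 * ?r * (p ?q + ?q * dp ?q)) (at t within {0..1})"
    by (auto intro!: derivative_eq_intros q dq simp: algebra_simps)
  then have dm: "((\<lambda>t. sqrt (1 + (c t \<bullet> c t) * p (c t \<bullet> c t))) has_real_derivative
      inverse m / 2 * (2 * ?r * (p ?q + ?q * dp ?q))) (at t within {0..1})"
    unfolding m_def
    by (rule DERIV_chain2[where f = sqrt and g = "\<lambda>t. 1 + (c t \<bullet> c t) * p (c t \<bullet> c t)",
          OF DERIV_real_sqrt[OF metric_det_pos]])
  have "m * ((- k * ?q + ?s) * m + ?r * (inverse m / 2 * (2 * ?r * (p ?q + ?q * dp ?q)))) =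
      - (k * (m * m)) * ?q + ?s * (m * m) + ?r * ?r * (p ?q + ?q * dp ?q)"
    using m(1) by (simp add: field_simps)
  also have "\<dots> = e * e"
    using k m(2) e(2) by algebra
  finally have "(- k * ?q + ?s) * m + ?r * (inverse m / 2 * (2 * ?r * (p ?q + ?q * dp ?q))) = e * e / m"
    using m(1) by (simp add: field_simps)
  moreover have "(signed_radius c has_real_derivative
     ((- k * ?q + ?s) * m + ?r * (inverse m / 2 * (2 * ?r * (p ?q + ?q * dp ?q)))) / e) (at t within {0..1})"
    unfolding signed_radius_def[abs_def] e_def[symmetric]
    by (rule DERIV_cong[OF DERIV_cdivide[OF DERIV_mult[OF has_real_derivative_inner[OF d] dm]]])
       (simp add: m_def[symmetric] algebra_simps)
  ultimately show ?thesis
    using e(1) unfolding e_def[symmetric] m_def[symmetric] by simp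
qed

text \<open>
  Here \<open>\<Phi>\<close> is the polar angle as a function of \<open>signed_radius\<close>, up to an additive constant. The angle
  itself never has to be lifted from the circle: rotating \<open>c t\<close> back by \<open>\<Phi>\<close> and normalising its length
  gives a curve with derivative zero, and \<open>(a, b)\<close> is its constant value.
\<close>

lemma geodesic_position:
  assumes c: "embedded_geodesic g c"
    and C: "C = angular_momentum c 0 / sqrt (energy c 0)" "C \<noteq> 0"
    and \<Phi>: "\<And>s. (\<Phi> has_real_derivative
      C * sqrt (1 + (C\<^sup>2 + s\<^sup>2) * p (C\<^sup>2 + s\<^sup>2)) / (C\<^sup>2 + s\<^sup>2)) (at s)"
  obtains a b where "\<And>t. t \<in> {0..1} \<Longrightarrow> c t = sqrt (c t \<bullet> c t) *\<^sub>R
      vector [a * cos (\<Phi> (signed_radius c t)) - b * sin (\<Phi> (signed_radius c t)),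
              a * sin (\<Phi> (signed_radius c t)) + b * cos (\<Phi> (signed_radius c t))]"
proof -
  define L where "L = angular_momentum c 0"
  define \<omega> where "\<omega> t = \<Phi> (signed_radius c t)" for t
  define X where "X t = (c t $ 1 * cos (\<omega> t) + c t $ 2 * sin (\<omega> t)) / sqrt (c t \<bullet> c t)" for t
  define Y where "Y t = (c t $ 2 * cos (\<omega> t) - c t $ 1 * sin (\<omega> t)) / sqrt (c t \<bullet> c t)" for t
  have q: "c t \<bullet> c t = C\<^sup>2 + (signed_radius c t)\<^sup>2" "c t \<bullet> c t > 0" if "t \<in> {0..1}" for t
    using signed_radius_square[OF c that] energy_pos[OF c] C
    by (auto simp: power_divide add_pos_nonneg)
  have d\<omega>: "(\<omega> has_real_derivative L / (c t \<bullet> c t)) (at t within {0..1})" if t: "t \<in> {0..1}" for t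
  proof -
    have "(\<omega> has_real_derivative C * sqrt (1 + (c t \<bullet> c t) * p (c t \<bullet> c t)) / (c t \<bullet> c t)
        * (sqrt (energy c 0) / sqrt (1 + (c t \<bullet> c t) * p (c t \<bullet> c t)))) (at t within {0..1})"
      unfolding \<omega>_def[abs_def]
      by (rule DERIV_chain2[OF \<Phi>[of "signed_radius c t", folded q(1)[OF t]] signed_radius_derivative[OF c t]])
    then show ?thesis
      using metric_det_pos[of "c t"] energy_pos[OF c] by (simp add: C(1) L_def)
  qed
  have dq: "((\<lambda>t. sqrt (c t \<bullet> c t)) has_real_derivative (c t \<bullet> velocity c t) / sqrt (c t \<bullet> c t)) (at t within {0..1})"
    if t: "t \<in> {0..1}" for t
  proof -
    note d = geodesic_derivatives(1)[OF c t]
    show ?thesis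
      by (rule DERIV_chain2[where f = sqrt and g = "\<lambda>t. c t \<bullet> c t",
            OF DERIV_real_sqrt[OF q(2)[OF t]] has_real_derivative_inner[OF d d], THEN DERIV_cong])
         (simp add: inner_commute divide_simps)
  qed
  have const: "(X has_real_derivative 0) (at t within {0..1})" "(Y has_real_derivative 0) (at t within {0..1})"
    if t: "t \<in> {0..1}" for t
  proof -
    define r where "r = sqrt (c t \<bullet> c t)"
    have r: "r > 0" "c t \<bullet> c t = r * r" using q(2)[OF t] by (auto simp: r_def)
    have L: "L = c t $ 1 * velocity c t $ 2 - c t $ 2 * velocity c t $ 1"
      using angular_momentum_const[OF c t] by (simp add: L_def angular_momentum_def)
    have v: "velocity c t $ 1 = ((c t \<bullet> velocity c t) * c t $ 1 - L * c t $ 2) / (r * r)"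
        "velocity c t $ 2 = ((c t \<bullet> velocity c t) * c t $ 2 + L * c t $ 1) / (r * r)"
      using r(1) unfolding r(2)[symmetric] L
      by (simp_all add: r(2) eq_divide_eq) (simp_all add: r(2)[symmetric] inner_vec_def sum_2 algebra_simps)
    note d = has_real_derivative_vec_nth[OF geodesic_derivatives(1)[OF c t]]
    show "(X has_real_derivative 0) (at t within {0..1})"
      unfolding X_def[abs_def]
      by (rule derivative_eq_intros d d\<omega>[OF t] dq[OF t] refl)+
         (use r in \<open>simp_all add: v r_def[symmetric] field_simps\<close>)
    show "(Y has_real_derivative 0) (at t within {0..1})"
      unfolding Y_def[abs_def]
      by (rule derivative_eq_intros d d\<omega>[OF t] dq[OF t] refl)+
         (use r in \<open>simp_all add: v r_def[symmetric] field_simps\<close>)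
  qed
  have "\<exists>a. \<forall>t\<in>{0..1}. X t = a" "\<exists>b. \<forall>t\<in>{0..1}. Y t = b"
    by (intro has_field_derivative_zero_constant const; simp)+
  then obtain a b where ab: "\<And>t. t \<in> {0..1} \<Longrightarrow> X t = a" "\<And>t. t \<in> {0..1} \<Longrightarrow> Y t = b"
    by blast
  show thesis
  proof
    fix t :: real assume t: "t \<in> {0..1}"
    have "sqrt (c t \<bullet> c t) > 0" using q(2)[OF t] by simp
    then have *: "sqrt (c t \<bullet> c t) * a = c t $ 1 * cos (\<omega> t) + c t $ 2 * sin (\<omega> t)"
      "sqrt (c t \<bullet> c t) * b = c t $ 2 * cos (\<omega> t) - c t $ 1 * sin (\<omega> t)"
      using ab[OF t] by (auto simp: X_def Y_def)
    have "(sin (\<omega> t))\<^sup>2 + (cos (\<omega> t))\<^sup>2 = 1" by simp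
    then have "c t $ 1 = sqrt (c t \<bullet> c t) * (a * cos (\<omega> t) - b * sin (\<omega> t))"
      "c t $ 2 = sqrt (c t \<bullet> c t) * (a * sin (\<omega> t) + b * cos (\<omega> t))"
      using * by algebra+
    then show "c t = sqrt (c t \<bullet> c t) *\<^sub>R
      vector [a * cos (\<Phi> (signed_radius c t)) - b * sin (\<Phi> (signed_radius c t)),
              a * sin (\<Phi> (signed_radius c t)) + b * cos (\<Phi> (signed_radius c t))]"
      unfolding \<omega>_def vec_eq_iff forall_2 by simp
  qed
qed

section \<open>Self-intersection of long chords\<close>

text \<open>
  Two points of the chord at opposite values \<open>\<plusminus>u\<close> of \<open>signed_radius\<close> are equally far from the origin, and
  their polar angles differ by \<open>2 * \<Phi> u\<close>. If \<open>\<bar>\<Phi>\<bar>\<close> exceeded \<open>pi\<close> at the end of the chord, it would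
  equal \<open>pi\<close> at some \<open>u > 0\<close>, and the two points would coincide.
\<close>

lemma chord_sweep_le_pi:
  assumes c: "embedded_geodesic g c" and ends: "norm (c 0) = 1" "norm (c 1) = 1"
    and C: "C = angular_momentum c 0 / sqrt (energy c 0)" "C \<noteq> 0"
    and \<Phi>: "\<And>s. (\<Phi> has_real_derivative
      C * sqrt (1 + (C\<^sup>2 + s\<^sup>2) * p (C\<^sup>2 + s\<^sup>2)) / (C\<^sup>2 + s\<^sup>2)) (at s)"
    and odd: "\<And>s. \<Phi> (- s) = - \<Phi> s"
  shows "\<bar>\<Phi> (sqrt (1 - C\<^sup>2))\<bar> \<le> pi"
proof (rule ccontr)
  assume "\<not> \<bar>\<Phi> (sqrt (1 - C\<^sup>2))\<bar> \<le> pi"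
  then have big: "\<bar>\<Phi> (sqrt (1 - C\<^sup>2))\<bar> > pi" by simp
  let ?\<sigma> = "signed_radius c"
  have q: "c t \<bullet> c t = C\<^sup>2 + (?\<sigma> t)\<^sup>2" if "t \<in> {0..1}" for t
    using signed_radius_square[OF c that] energy_pos[OF c] C by (simp add: power_divide)
  have cont: "continuous_on {0..1} ?\<sigma>"
    by (rule DERIV_continuous_on[OF signed_radius_derivative[OF c]])
  have "?\<sigma> 0 < ?\<sigma> 1"
  proof (rule DERIV_pos_imp_increasing_open[OF _ _ cont])
    fix t :: real assume t: "0 < t" "t < 1"
    have "sqrt (energy c 0) / sqrt (1 + (c t \<bullet> c t) * p (c t \<bullet> c t)) > 0"
      using energy_pos[OF c] metric_det_pos[of "c t"] by simp
    with signed_radius_derivative[OF c, of t] t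
    show "\<exists>y. DERIV ?\<sigma> t :> y \<and> y > 0"
      by (auto simp: at_within_Icc_at)
  qed simp
  moreover have "(?\<sigma> 0)\<^sup>2 = 1 - C\<^sup>2" "(?\<sigma> 1)\<^sup>2 = 1 - C\<^sup>2"
    using q[of 0] q[of 1] ends by (simp_all add: norm_eq_1)
  ultimately have s: "?\<sigma> 0 = - sqrt (1 - C\<^sup>2)" "?\<sigma> 1 = sqrt (1 - C\<^sup>2)"
    by (smt (verit) power2_eq_iff real_sqrt_abs)+
  have s0: "sqrt (1 - C\<^sup>2) \<ge> 0"
    using \<open>?\<sigma> 0 < ?\<sigma> 1\<close> s by linarith
  have "\<Phi> 0 = 0" using odd[of 0] by simp
  moreover have "continuous_on {0..sqrt (1 - C\<^sup>2)} (\<lambda>s. \<bar>\<Phi> s\<bar>)"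
    using \<Phi> by (intro continuous_intros DERIV_atLeastAtMost_imp_continuous_on) blast
  ultimately obtain u where u: "0 \<le> u" "u \<le> sqrt (1 - C\<^sup>2)" "\<bar>\<Phi> u\<bar> = pi"
    using IVT'[of "\<lambda>s. \<bar>\<Phi> s\<bar>" 0 pi "sqrt (1 - C\<^sup>2)"] big s0 by auto
  obtain t1 where t1: "0 \<le> t1" "t1 \<le> 1" "?\<sigma> t1 = - u"
    using IVT'[OF _ _ _ cont, of "- u"] u s by auto
  obtain t2 where t2: "0 \<le> t2" "t2 \<le> 1" "?\<sigma> t2 = u"
    using IVT'[OF _ _ _ cont, of "u"] u s by auto
  have "u \<noteq> 0" using u \<open>\<Phi> 0 = 0\<close> by auto
  obtain a b where ab: "\<And>t. t \<in> {0..1} \<Longrightarrow> c t = sqrt (c t \<bullet> c t) *\<^sub>R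
      vector [a * cos (\<Phi> (?\<sigma> t)) - b * sin (\<Phi> (?\<sigma> t)),
              a * sin (\<Phi> (?\<sigma> t)) + b * cos (\<Phi> (?\<sigma> t))]"
    using geodesic_position[OF c C \<Phi>] by blast
  have "\<Phi> u = pi \<or> \<Phi> u = - pi" using u(3) by linarith
  then have sc: "sin (\<Phi> (?\<sigma> t1)) = sin (\<Phi> (?\<sigma> t2))" "cos (\<Phi> (?\<sigma> t1)) = cos (\<Phi> (?\<sigma> t2))"
    unfolding t1 t2 odd by auto
  have "c t1 = c t2"
    using ab[of t1] ab[of t2] q[of t1] q[of t2] t1 t2 by (simp add: sc[unfolded t1 t2])
  moreover have "inj_on c {0..1}"
    using c unfolding embedded_geodesic_def arc_def by blast
  ultimately have "t1 = t2" using t1 t2 by (auto dest: inj_onD)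
  with t1 t2 \<open>u \<noteq> 0\<close> show False by auto
qed

text \<open>
  At a boundary point the component of the unit velocity along the unit tangent of the circle is
  \<open>C = L / sqrt E\<close>, which is Clairaut's constant because the circle has radius 1.
\<close>

lemma contact_angle_angular_momentum:
  assumes c: "embedded_geodesic g c"
    and contact: "contact_angle g \<theta> A (c 0) (- velocity c 0)"
  shows "norm (c 0) = 1" and "(angular_momentum c 0 / sqrt (energy c 0))\<^sup>2 = (cos \<theta>)\<^sup>2"
proof -
  obtain \<nu> a s where \<nu>: "gnorm g (c 0) \<nu> = 1" "c 0 = bd_pt a"
      "\<nu> = s *\<^sub>R vector [- sin a, cos a]"
    and i: "ginner g (c 0) ((- velocity c 0) /\<^sub>R gnorm g (c 0) (- velocity c 0)) \<nu> = - cos \<theta>"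
    using contact unfolding contact_angle_def outward_tangent_def vector_derivative_bd_pt by blast
  show "norm (c 0) = 1" unfolding \<nu>(2) norm_eq_1 by (rule bd_pt_inner)
  have "ginner g (c 0) \<nu> \<nu> = s\<^sup>2"
    unfolding ginner_radial_metric \<nu>(2,3) by (simp add: bd_pt_inner power2_eq_square)
  then have s: "s\<^sup>2 = 1" using \<nu>(1) unfolding gnorm_def by (simp only: real_sqrt_eq_1_iff)
  have n: "gnorm g (c 0) (- velocity c 0) = sqrt (energy c 0)"
    unfolding gnorm_def energy_def ginner_radial_metric by simp
  have "ginner g (c 0) ((- velocity c 0) /\<^sub>R sqrt (energy c 0)) \<nu> =
      - s * (angular_momentum c 0 / sqrt (energy c 0))"
    unfolding ginner_radial_metric \<nu>(3) angular_momentum_def \<nu>(2)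
    by (simp add: bd_pt_inner) (simp add: bd_pt_def inner_vec_def sum_2 field_simps)
  with i have "cos \<theta> = s * (angular_momentum c 0 / sqrt (energy c 0))" unfolding n by simp
  then show "(angular_momentum c 0 / sqrt (energy c 0))\<^sup>2 = (cos \<theta>)\<^sup>2"
    using s by (simp add: power_mult_distrib power_divide)
qed

end

section \<open>The rounded cone\<close>

text \<open>
  This is \<open>(M\<^sup>2 - 1) / q\<close> for \<open>M = 1 + c * q / (q + e)\<close>, written so that the pole at \<open>q = 0\<close> is
  visibly removed. Far from the apex (\<open>q\<close> much larger than \<open>e\<close>) the metric is close to
  \<open>(1 + c)\<^sup>2 dr\<^sup>2 + r\<^sup>2 d\<phi>\<^sup>2\<close>, a flat cone of angle \<open>2 * pi / (1 + c)\<close>.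
\<close>

definition cone_profile :: "real \<Rightarrow> real \<Rightarrow> real \<Rightarrow> real" where
  "cone_profile c e q = c * inverse (q + e) * (2 + c * q * inverse (q + e))"

lemma cone_profile_square:
  "1 + q * cone_profile c e q = (1 + c * q / (q + e))\<^sup>2"
  by (simp add: cone_profile_def divide_inverse power2_eq_square algebra_simps)

definition cone_profile' :: "real \<Rightarrow> real \<Rightarrow> real \<Rightarrow> real" where
  "cone_profile' c e q = c * (c - 2) * inverse (q + e) ^ 2 - 2 * c\<^sup>2 * q * inverse (q + e) ^ 3"

lemma cone_profile_deriv:
  assumes "q + e \<noteq> 0"
  shows "(cone_profile c e has_real_derivative cone_profile' c e q) (at q)"
  unfolding cone_profile_def[abs_def] cone_profile'_def
  using assms by (auto intro!: derivative_eq_intros simp: algebra_simps power2_eq_square power3_eq_cube)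

text \<open>
  The expression is the derivative of \<open>M\<^sup>2\<close>, and \<open>M\<close> is positive and increasing.
\<close>

lemma cone_profile_curvature_nonneg:
  assumes "c > 0" "e > 0" "q \<ge> 0"
  shows "cone_profile c e q + q * cone_profile' c e q \<ge> 0"
proof -
  define u where "u = inverse (q + e)"
  have "u > 0" "u * (q + e) = 1" using assms by (auto simp: u_def)
  then have "cone_profile c e q + q * cone_profile' c e q = 2 * (1 + c * q * u) * (c * e * u\<^sup>2)"
    unfolding cone_profile_def cone_profile'_def u_def[symmetric] by algebra
  also have "\<dots> \<ge> 0" using assms \<open>u > 0\<close> by simp
  finally show ?thesis .
qed

lemma smooth_profile_cone:
  assumes "c > 0" "e > 0"
  shows "smooth_profile (cone_profile c e) (cone_profile' c e)"
proof
  fix q :: real assume "q \<ge> 0"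
  with assms have nz: "q + e \<noteq> 0" by simp
  then show "(cone_profile c e has_real_derivative cone_profile' c e q) (at q)"
    by (rule cone_profile_deriv)
  show "cone_profile' c e differentiable (at q)"
    unfolding cone_profile'_def[abs_def] using nz
    by (intro differentiable_diff differentiable_mult differentiable_power differentiable_inverse
        differentiable_add differentiable_const differentiable_ident) auto
  show "cone_profile c e q \<ge> 0"
    using assms \<open>q \<ge> 0\<close> by (simp add: cone_profile_def)
qed

lemma C_k_on_cone_profile:
  assumes "e > 0"
  shows "C_k_on k (\<lambda>x. cone_profile c e (x \<bullet> x)) UNIV"
proof -
  have "x \<bullet> x + e \<noteq> 0" for x :: "real^2" using assms by (simp add: add_nonneg_eq_0_iff)
  moreover have "C_k_on k (\<lambda>x. x \<bullet> x) UNIV"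
    unfolding inner_self_2 by (intro C_k_on_add C_k_on_mult C_k_on_coord)
  ultimately show ?thesis
    unfolding cone_profile_def by (intro C_k_on_add C_k_on_mult C_k_on_const C_k_on_inverse)
qed

text \<open>
  The odd primitive of \<open>C * M q / q = C / q + c * C / (q + e)\<close> in \<open>s\<close>, where \<open>q = C\<^sup>2 + s\<^sup>2\<close>: the
  polar angle swept between the point closest to the apex and the point with \<open>signed_radius\<close> \<open>s\<close>.
\<close>

definition cone_sweep :: "real \<Rightarrow> real \<Rightarrow> real \<Rightarrow> real \<Rightarrow> real" where
  "cone_sweep c e C s = arctan (s / C) + c * C / sqrt (C\<^sup>2 + e) * arctan (s / sqrt (C\<^sup>2 + e))"

lemma cone_sweep_deriv:
  assumes "c > 0" "e > 0" "C \<noteq> 0"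
  shows "(cone_sweep c e C has_real_derivative
      C * sqrt (1 + (C\<^sup>2 + s\<^sup>2) * cone_profile c e (C\<^sup>2 + s\<^sup>2)) / (C\<^sup>2 + s\<^sup>2)) (at s)"
proof -
  define q where "q = C\<^sup>2 + s\<^sup>2"
  define r where "r = sqrt (C\<^sup>2 + e)"
  have q: "q > 0" using assms(3) by (simp add: q_def add_pos_nonneg)
  have r: "r > 0" "r\<^sup>2 = C\<^sup>2 + e" using assms(2) by (auto simp: r_def add_nonneg_pos)
  have "1 + c * q / (q + e) \<ge> 0" using q assms by simp
  then have sq: "sqrt (1 + q * cone_profile c e q) = 1 + c * q / (q + e)"
    using cone_profile_square[of q c e] by simp
  have inv: "inverse (1 + (s / y)\<^sup>2) / y = y / (y\<^sup>2 + s\<^sup>2)" if "y \<noteq> 0" for y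
  proof -
    have "1 + (s / y)\<^sup>2 = (y\<^sup>2 + s\<^sup>2) / y\<^sup>2"
      using that by (simp add: power_divide add_divide_distrib)
    then show ?thesis using that by (simp add: power2_eq_square)
  qed
  have arctan_scaled:
    "((\<lambda>s. arctan (s / y)) has_real_derivative inverse (1 + (s / y)\<^sup>2) / y) (at s)" for y
    by (rule DERIV_chain2[OF DERIV_arctan DERIV_cdivide[OF DERIV_ident], THEN DERIV_cong]) simp
  have "inverse (1 + (s / C)\<^sup>2) / C = C / q"
    using inv[OF assms(3)] by (simp add: q_def)
  moreover have "inverse (1 + (s / r)\<^sup>2) / r = r / (q + e)"
    using inv[of r] r by (simp add: q_def algebra_simps)
  moreover have "(cone_sweep c e C has_real_derivative
      inverse (1 + (s / C)\<^sup>2) / C + c * C / r * (inverse (1 + (s / r)\<^sup>2) / r)) (at s)"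
    unfolding cone_sweep_def[abs_def] r_def[symmetric]
    by (rule DERIV_add[OF arctan_scaled DERIV_cmult[OF arctan_scaled]])
  ultimately have "(cone_sweep c e C has_real_derivative C / q + c * C / r * (r / (q + e))) (at s)"
    by simp
  moreover have "C / q + c * C / r * (r / (q + e)) = C * (1 + c * q / (q + e)) / q"
    using q r(1) by (simp add: distrib_left add_divide_distrib)
  ultimately show ?thesis unfolding q_def[symmetric] sq by simp
qed

text \<open>
  As the rounding parameter \<open>e\<close> tends to 0, both arctangents tend to \<open>\<theta>\<close>, and the limit
  \<open>2 * pi * \<theta> / k\<close> is half of the angle that the chord winds around the flat cone of angle \<open>k\<close>.
\<close>

lemma ex_cone_sweep_gt_pi:
  assumes "k > 0" "k / 2 < \<theta>" "\<theta> < pi / 2"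
  obtains e where "e > 0" "cone_sweep ((1 + e) * (2 * pi / k - 1)) e (cos \<theta>) (sin \<theta>) > pi"
proof -
  have "cos \<theta> > 0" using assms by (intro cos_gt_zero) auto
  then have "((\<lambda>e. cone_sweep ((1 + e) * (2 * pi / k - 1)) e (cos \<theta>) (sin \<theta>)) \<longlongrightarrow>
      cone_sweep ((1 + 0) * (2 * pi / k - 1)) 0 (cos \<theta>) (sin \<theta>)) (at_right 0)"
    unfolding cone_sweep_def by (intro tendsto_intros) auto
  moreover have "arctan (sin \<theta> / cos \<theta>) = \<theta>"
    using arctan_tan[of \<theta>] assms by (simp add: tan_def)
  then have "cone_sweep ((1 + 0) * (2 * pi / k - 1)) 0 (cos \<theta>) (sin \<theta>) = 2 * pi * \<theta> / k"
    using \<open>cos \<theta> > 0\<close> assms(1) by (simp add: cone_sweep_def field_simps)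
  moreover have "2 * pi * \<theta> / k > pi"
    using assms(1,2) by (simp add: field_simps)
  ultimately have "\<forall>\<^sub>F e in at_right 0.
      cone_sweep ((1 + e) * (2 * pi / k - 1)) e (cos \<theta>) (sin \<theta>) > pi"
    by (simp only: order_tendstoD)
  then have "\<forall>\<^sub>F e in at_right 0.
      e > 0 \<and> cone_sweep ((1 + e) * (2 * pi / k - 1)) e (cos \<theta>) (sin \<theta>) > pi"
    by (intro eventually_conj eventually_at_right_less)
  then obtain e :: real
    where "e > 0 \<and> cone_sweep ((1 + e) * (2 * pi / k - 1)) e (cos \<theta>) (sin \<theta>) > pi"
    using eventually_happens by force
  then show thesis using that by blast
qed

section \<open>Nonexistence of capillary geodesics\<close>

theorem proposition1p2:
  fixes k :: real
  assumes "0 < k" and "k < pi"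
  shows "\<exists>g. riemannian_disk g \<and> strictly_convex_bdry g \<and>
           (\<forall>x\<in>D2. gauss_curvature g x \<ge> 0) \<and>
           ((\<lambda>t. bd_curvature g t * bd_speed g t) has_integral k) {0..2 * pi} \<and>
           (\<exists>\<theta>. 0 < \<theta> \<and> \<theta> < pi / 2 \<and>
              \<not> (\<exists>\<gamma>. capillary_embedded_geodesic g \<theta> \<gamma>))"
proof -
  \<comment> \<open>the midpoint of the interval from \<open>k / 2\<close> to \<open>pi / 2\<close>\<close>
  define \<theta> where "\<theta> = (k + pi) / 4"
  have \<theta>: "0 < \<theta>" "k / 2 < \<theta>" "\<theta> < pi / 2" using assms by (auto simp: \<theta>_def)
  obtain e where e: "e > 0" "cone_sweep ((1 + e) * (2 * pi / k - 1)) e (cos \<theta>) (sin \<theta>) > pi"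
    using ex_cone_sweep_gt_pi[OF assms(1) \<theta>(2,3)] .
  \<comment> \<open>This value makes \<open>M 1 = 1 + c / (1 + e)\<close> equal to \<open>2 * pi / k\<close>.\<close>
  define c where "c = (1 + e) * (2 * pi / k - 1)"
  have "2 * pi / k > 1" using assms by (simp add: less_divide_eq)
  then have c: "c > 0" using e(1) by (simp add: c_def)
  interpret smooth_profile "cone_profile c e" "cone_profile' c e"
    by (rule smooth_profile_cone[OF c e(1)])
  have "1 + cone_profile c e 1 = (1 + c / (1 + e))\<^sup>2"
    using cone_profile_square[of 1 c e] by simp
  also have "1 + c / (1 + e) = 2 * pi / k"
    using e(1) by (simp add: c_def)
  finally have "sqrt (1 + cone_profile c e 1) = 2 * pi / k"
    using assms(1) by (simp add: real_sqrt_divide)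
  then have \<kappa>: "bd_curvature g t = k / (2 * pi)" for t
    by (simp add: bd_curvature_radial_metric)
  have "\<not> capillary_embedded_geodesic g \<theta> \<gamma>" for \<gamma>
  proof
    assume "capillary_embedded_geodesic g \<theta> \<gamma>"
    then obtain A x where x: "embedded_geodesic g x" "pathfinish x \<in> bdry_D2"
        "contact_angle g \<theta> A (pathstart x) (- velocity x 0)"
      unfolding capillary_embedded_geodesic_def by blast
    define C where "C = angular_momentum x 0 / sqrt (energy x 0)"
    have C: "C\<^sup>2 = (cos \<theta>)\<^sup>2" and start: "norm (x 0) = 1"
      using contact_angle_angular_momentum[OF x(1)] x(3) by (auto simp: C_def pathstart_def)
    have "cos \<theta> > 0" "sin \<theta> > 0" using \<theta> by (auto intro!: cos_gt_zero sin_gt_zero)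
    then have "C \<noteq> 0" using C by auto
    have "\<bar>cone_sweep c e C (sqrt (1 - C\<^sup>2))\<bar> \<le> pi"
    proof (rule chord_sweep_le_pi[OF x(1) start _ C_def \<open>C \<noteq> 0\<close>])
      show "norm (x 1) = 1" using x(2) by (simp add: pathfinish_def)
      show "cone_sweep c e C (- s) = - cone_sweep c e C s" for s
        by (simp add: cone_sweep_def arctan_minus)
    qed (rule cone_sweep_deriv[OF c e(1) \<open>C \<noteq> 0\<close>])
    moreover have "sqrt (1 - C\<^sup>2) = sin \<theta>"
      using \<open>sin \<theta> > 0\<close> by (simp add: C sin_squared_eq[symmetric])
    moreover have "C = cos \<theta> \<or> C = - cos \<theta>"
      using C by (simp add: power2_eq_iff)
    moreover have "cone_sweep c e (- cos \<theta>) (sin \<theta>) = - cone_sweep c e (cos \<theta>) (sin \<theta>)"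
      by (simp add: cone_sweep_def arctan_minus)
    ultimately show False using e(2) unfolding c_def[symmetric] by auto
  qed
  moreover have "riemannian_disk g"
    by (rule riemannian_disk_radial_metric[OF C_k_on_cone_profile[OF e(1)]])
  moreover have "strictly_convex_bdry g"
    using assms(1) by (simp add: strictly_convex_bdry_def \<kappa>)
  moreover have "gauss_curvature g x \<ge> 0" for x
    unfolding gauss_curvature_radial_metric
    using cone_profile_curvature_nonneg[OF c e(1), of "x \<bullet> x"] by simp
  moreover have "((\<lambda>t. bd_curvature g t * bd_speed g t) has_integral k) {0..2 * pi}"
    using has_integral_const_real[of "k / (2 * pi)" 0 "2 * pi"]
    by (simp add: \<kappa> bd_speed_radial_metric)
  ultimately show ?thesis using \<theta>(1,3) by blast
qed

end
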